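(* If $S=\bigcup_{i=1}^kI_i$ is a union of $k\ge2$ closed bounded intervals $I_i\subset\mathbb R$ of positive length, then $\kappa(S)\le\log k+\log\log k+5$. Consequently there is a function $\varepsilon(k)\to0$ as $k\to\infty$ such that every such $S$ satisfies $e(S)\ge(1-\varepsilon(k))/\log k$.
   Context: For a measurable $S\subset\mathbb R$ with non-empty interior and $x>0$, $\tau(S,x)=\min\{|T|:T\subset\mathbb R,\ T+S\supseteq[0,x]\}$; $\tau(S)=\lim_{x\to\infty}\tau(S,x)/x$ (which exists); $\kappa(S)=\tau(S)\lambda(S)$ with $\lambda$ Lebesgue measure, and $e(S)=1/\kappa(S)$. $\log$ is the natural logarithm. *)

theory Defs
  imports "HOL-Analysis.Analysis"
begin

text \<open>Since \<open>card\<close> of an infinite set is \<open>0\<close>, finiteness of the translation set is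
  required explicitly. If \<open>S\<close> has non-empty interior, a finite \<open>T\<close> exists, so the minimum is
  attained.\<close>
definition tau_upto :: "real set \<Rightarrow> real \<Rightarrow> nat" where
  "tau_upto S x =
     (LEAST n. \<exists>T. finite T \<and> card T = n \<and> {0..x} \<subseteq> {t + s |t s. t \<in> T \<and> s \<in> S})"

definition tau :: "real set \<Rightarrow> real" where
  "tau S = Lim at_top (\<lambda>x. real (tau_upto S x) / x)"

text \<open>Intended for \<open>S\<close> of finite measure: \<open>measure\<close> of a set of infinite measure is \<open>0\<close>.\<close>
definition kappa :: "real set \<Rightarrow> real" where
  "kappa S = tau S * measure lebesgue S"

definition efficiency :: "real set \<Rightarrow> real" where
  "efficiency S = 1 / kappa S"

text \<open>The intervals are not required to be disjoint or distinct.\<close>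
definition union_of_intervals :: "nat \<Rightarrow> real set \<Rightarrow> bool" where
  "union_of_intervals k S \<longleftrightarrow>
     (\<exists>a b :: nat \<Rightarrow> real. (\<forall>i\<in>{1..k}. a i < b i) \<and> S = (\<Union>i\<in>{1..k}. {a i..b i}))"

end

theory Submission
  imports Defs "HOL-Real_Asymp.Real_Asymp"
begin

text \<open>Cut the line into cells of length \<open>h = \<lambda>(S) / M\<close>. At most \<open>M\<close> cells lie inside \<open>S\<close>, and at
  least \<open>M - 2k\<close> do, since only the cells containing an endpoint are lost. For the set \<open>A\<close> of these
  cells, a greedy covering of a long integer interval by translates of \<open>A\<close> uses asymptotically
  \<open>(1 + ln |A|) / |A|\<close> translates per cell, whence
  \<open>\<kappa>(S) \<le> (1 + ln M) M / (M - 2k)\<close>; take \<open>M\<close> of order \<open>k ln k\<close>. Fekete's lemma makes \<open>\<tau>(S)\<close> an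
  infimum, so coverings of arbitrary lengths bound it from above.\<close>

section \<open>Fekete's lemma for functions of a real variable\<close>

text \<open>Monotonicity lets \<open>x\<close> be rounded up to a multiple of \<open>y\<close>; this
  costs at most one extra \<open>f y\<close>, which vanishes after division by
  \<open>x\<close>.\<close>

lemma fekete_real:
  fixes f :: "real \<Rightarrow> real"
  assumes nonneg: "\<And>x. f x \<ge> 0"
    and mono: "mono f"
    and subadd: "\<And>x y. x > 0 \<Longrightarrow> y > 0 \<Longrightarrow> f (x + y) \<le> f x + f y"
  shows "((\<lambda>x. f x / x) \<longlongrightarrow> (INF x\<in>{0<..}. f x / x)) at_top"
proof -
  define l where "l = (INF x\<in>{0<..}. f x / x)"
  have bdd: "bdd_below ((\<lambda>x. f x / x) ` {0<..})"
    by (rule bdd_belowI[of _ 0]) (auto simp: nonneg)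
  have l_le: "l \<le> f x / x" if "x > 0" for x
    unfolding l_def by (rule cINF_lower[OF bdd]) (use that in auto)
  \<comment> \<open>Starting from one copy of \<open>y\<close> avoids \<open>f 0 \<le> 0\<close>,
    which is not assumed.\<close>
  have mult: "f (real (Suc n) * y) \<le> real (Suc n) * f y" if "y > 0" for n y
  proof (induction n)
    case (Suc n)
    have "real (Suc (Suc n)) * y = real (Suc n) * y + y" by (simp add: algebra_simps)
    then have "f (real (Suc (Suc n)) * y) \<le> f (real (Suc n) * y) + f y"
      using subadd[of "real (Suc n) * y" y] that by simp
    then show ?case using Suc by (simp add: algebra_simps)
  qed simp
  have upper: "f x / x \<le> f y / y + f y / x" if "x > 0" "y > 0" for x y
  proof -
    define n where "n = nat \<lfloor>x / y\<rfloor>"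
    have n: "real n \<le> x / y" "x / y \<le> real (Suc n)"
      using that unfolding n_def by (auto simp: of_nat_nat) linarith+
    have "f x \<le> f (real (Suc n) * y)"
      using n that by (intro monoD[OF mono]) (simp add: field_simps)
    also have "\<dots> \<le> real (Suc n) * f y" using mult that by blast
    also have "\<dots> \<le> (x / y + 1) * f y"
      using n nonneg by (intro mult_right_mono) auto
    finally show ?thesis using that by (simp add: field_simps)
  qed
  have "((\<lambda>x. f x / x) \<longlongrightarrow> l) at_top"
  proof (rule order_tendstoI)
    fix c assume "c < l"
    show "eventually (\<lambda>x. c < f x / x) at_top"
      using eventually_gt_at_top[of 0]
    proof eventually_elim
      case (elim x)
      then show ?case using l_le[of x] \<open>c < l\<close> by linarith
    qed
  next
    fix c assume "l < c"
    then obtain y where y: "y > 0" "f y / y < c"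
      unfolding l_def using cINF_less_iff[OF _ bdd, of c] by auto
    have "((\<lambda>x. f y / y + f y / x) \<longlongrightarrow> f y / y + 0) at_top"
      by (intro tendsto_add tendsto_const real_tendsto_divide_at_top[of _ "f y"] filterlim_ident)
    then have "eventually (\<lambda>x. f y / y + f y / x < c) at_top"
      using y by (intro order_tendstoD) auto
    then show "eventually (\<lambda>x. f x / x < c) at_top"
      using eventually_gt_at_top[of 0] by eventually_elim (use upper y in force)
  qed
  then show ?thesis by (simp add: l_def)
qed

section \<open>Greedy covering of finite sets\<close>

text \<open>Each greedy step shrinks the uncovered part by the factor \<open>1 - a / m\<close>, since an average
  one of the \<open>m\<close> sets contains at least the fraction \<open>a / m\<close> of it.\<close>
lemma greedy_steps:
  fixes F :: "'b \<Rightarrow> 'a set"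
  assumes "finite U" "finite I" "I \<noteq> {}"
    and deg: "\<And>u. u \<in> U \<Longrightarrow> a \<le> card {i \<in> I. u \<in> F i}"
  shows "\<exists>T\<subseteq>I. card T \<le> p \<and>
    real (card (U - (\<Union>i\<in>T. F i))) \<le> real (card U) * (1 - real a / real (card I)) ^ p"
proof (induction p)
  case 0
  then show ?case by (intro exI[of _ "{}"]) auto
next
  case (Suc p)
  then obtain T where T: "T \<subseteq> I" "card T \<le> p"
    "real (card (U - (\<Union>i\<in>T. F i))) \<le> real (card U) * (1 - real a / real (card I)) ^ p"
    by blast
  define R where "R = U - (\<Union>i\<in>T. F i)"
  have finR: "finite R" using assms by (simp add: R_def)
  have m: "card I > 0" using assms by (simp add: card_gt_0_iff)
  \<comment> \<open>Incidences between \<open>R\<close> and \<open>I\<close> are counted in two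
    ways; some \<open>i\<close> then covers at least the average number of points of
    \<open>R\<close>.\<close>
  have "card R * a \<le> (\<Sum>u\<in>R. card {i \<in> I. u \<in> F i})"
    using sum_mono[of R "\<lambda>_. a"] deg by (simp add: R_def)
  also have "\<dots> = (\<Sum>i\<in>I. card {u \<in> R. u \<in> F i})"
    using sum_multicount_gen[of I R "\<lambda>i u. u \<in> F i"
      "\<lambda>u. card {i \<in> I. u \<in> F i}"] finR assms by simp
  finally have dc: "card R * a \<le> (\<Sum>i\<in>I. card {u \<in> R. u \<in> F i})" .
  have "\<exists>i\<in>I. real (card R) * (real a / card I) \<le> card {u \<in> R. u \<in> F i}"
  proof (rule ccontr)
    assume "\<not> ?thesis"
    then have "(\<Sum>i\<in>I. real (card {u \<in> R. u \<in> F i})) < (\<Sum>i\<in>I. real (card R) * (real a / card I))"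
      using assms by (intro sum_strict_mono) auto
    also have "\<dots> = real (card R * a)" using m by simp
    finally show False using dc by (metis of_nat_le_iff of_nat_sum not_le)
  qed
  then obtain i where i: "i \<in> I" "real (card R) * (real a / card I) \<le> card {u \<in> R. u \<in> F i}"
    by blast
  have "U - (\<Union>i\<in>insert i T. F i) = R - {u \<in> R. u \<in> F i}" by (auto simp: R_def)
  then have "card (U - (\<Union>i\<in>insert i T. F i)) = card R - card {u \<in> R. u \<in> F i}"
    using finR by (simp add: card_Diff_subset)
  then have "real (card (U - (\<Union>i\<in>insert i T. F i))) = real (card R) - card {u \<in> R. u \<in> F i}"
    using card_mono[OF finR, of "{u \<in> R. u \<in> F i}"] by auto
  also have "\<dots> \<le> card R * (1 - real a / card I)" using i by (simp add: algebra_simps)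
  finally have step: "real (card (U - (\<Union>i\<in>insert i T. F i))) \<le> card R * (1 - real a / card I)" .
  show ?case
  \<comment> \<open>A point of \<open>U\<close> yields \<open>a \<le> card I\<close>, so that the
    shrinking factor is nonnegative and the induction hypothesis can be multiplied by it.\<close>
  proof (cases "U = {}")
    case True
    then show ?thesis by (intro exI[of _ "{}"]) auto
  next
    case False
    then obtain u where "u \<in> U" by blast
    then have "a \<le> card I" using deg[of u] card_mono[OF assms(2), of "{i \<in> I. u \<in> F i}"] by simp
    then have "card R * (1 - real a / card I)
        \<le> real (card U) * (1 - real a / card I) ^ p * (1 - real a / card I)"
      using T(3) m by (intro mult_right_mono) (auto simp: R_def)
    with step have "real (card (U - (\<Union>i\<in>insert i T. F i)))
        \<le> real (card U) * (1 - real a / real (card I)) ^ Suc p" by (simp add: mult_ac)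
    moreover have "card (insert i T) \<le> Suc p"
      using T card_insert_le_m1[of "Suc p" T i] by (simp add: card_insert_if finite_subset[OF _ assms(2)])
    ultimately show ?thesis using i T by (intro exI[of _ "insert i T"]) auto
  qed
qed

text \<open>After about \<open>(m / a) ln a\<close> greedy steps at most \<open>|U| / a\<close> points are left, and these are
  covered one at a time.\<close>
lemma stein_lovasz_cover:
  fixes F :: "'b \<Rightarrow> 'a set"
  assumes "finite U" "finite I" "a > 0"
    and deg: "\<And>u. u \<in> U \<Longrightarrow> a \<le> card {i \<in> I. u \<in> F i}"
  shows "\<exists>T\<subseteq>I. U \<subseteq> (\<Union>i\<in>T. F i) \<and>
    real (card T) \<le> real (card I) / a * ln a + 1 + real (card U) / a"
proof (cases "U = {}")
  case True
  then show ?thesis using assms by (intro exI[of _ "{}"]) auto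
next
  case False
  then obtain u where "u \<in> U" by blast
  then have am: "a \<le> card I" using deg[of u] card_mono[OF assms(2), of "{i \<in> I. u \<in> F i}"] by simp
  define m where "m = card I"
  have m: "m > 0" "a \<le> m" using am assms by (auto simp: m_def)
  have "I \<noteq> {}" using am assms by auto
  define p where "p = nat \<lceil>real m / a * ln a\<rceil>"
  have p0: "real m / a * ln a \<ge> 0" using assms by simp
  have p: "real p \<ge> real m / a * ln a" "real p \<le> real m / a * ln a + 1"
    using p0 unfolding p_def by linarith+
  obtain T where T: "T \<subseteq> I" "card T \<le> p"
    "real (card (U - (\<Union>i\<in>T. F i))) \<le> real (card U) * (1 - real a / m) ^ p"
    using greedy_steps[OF assms(1,2) \<open>I \<noteq> {}\<close> deg, where p = p] unfolding m_def by blast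
  \<comment> \<open>By \<open>1 - x \<le> exp (- x)\<close> and the choice of \<open>p\<close>, the
    fraction left is at most \<open>exp (- ln a)\<close>.\<close>
  have "(1 - real a / m) ^ p \<le> exp (- (real a / m)) ^ p"
    using exp_ge_add_one_self[of "- (real a / m)"] m by (intro power_mono) auto
  also have "\<dots> = exp (- (real p * (real a / m)))" by (simp add: exp_of_nat_mult[symmetric])
  also have "\<dots> \<le> exp (- ln a)"
    using p(1) m assms by (simp add: field_simps)
  also have "\<dots> = 1 / a" using assms by (simp add: exp_minus inverse_eq_divide)
  finally have "real (card U) * (1 - real a / m) ^ p \<le> real (card U) * (1 / a)"
    by (intro mult_left_mono) auto
  define R where "R = U - (\<Union>i\<in>T. F i)"
  have R: "real (card R) \<le> real (card U) / a"
    using T(3) \<open>real (card U) * (1 - real a / m) ^ p \<le> _\<close> by (simp add: R_def)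
  have "\<exists>i\<in>I. u \<in> F i" if "u \<in> R" for u
  proof -
    have "card {i \<in> I. u \<in> F i} > 0" using deg[of u] that \<open>a > 0\<close> by (simp add: R_def)
    then show ?thesis by (auto simp: card_gt_0_iff)
  qed
  then obtain g where g: "\<And>u. u \<in> R \<Longrightarrow> g u \<in> I \<and> u \<in> F (g u)" by metis
  have "card (T \<union> g ` R) \<le> card T + card (g ` R)" by (rule card_Un_le)
  also have "card (g ` R) \<le> card R" using assms by (intro card_image_le) (simp add: R_def)
  finally have "real (card (T \<union> g ` R)) \<le> p + real (card R)" using T by linarith
  with p R have "real (card (T \<union> g ` R)) \<le> real m / a * ln a + 1 + real (card U) / a" by linarith
  then show ?thesis using T g
    by (intro exI[of _ "T \<union> g ` R"]) (auto simp: m_def R_def)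
qed

section \<open>Covering integer intervals by translates\<close>

text \<open>Each point \<open>u\<close> lies in the \<open>card A\<close> translates with
  \<open>t = u - s\<close>, which is the degree that \<open>stein_lovasz_cover\<close> asks for.
  Since \<open>c\<close> does not depend on \<open>n\<close>, it disappears in the limit.\<close>

lemma integer_translates_cover:
  fixes A :: "int set"
  assumes "finite A" "A \<noteq> {}"
  shows "\<exists>c. \<forall>n::nat. \<exists>T. finite T \<and> {0..int n} \<subseteq> {t + s |t s. t \<in> T \<and> s \<in> A} \<and>
    real (card T) \<le> (real n + c) * ((1 + ln (card A)) / card A) + 1"
proof -
  obtain D where D: "\<And>s. s \<in> A \<Longrightarrow> \<bar>s\<bar> \<le> D" "D \<ge> 0"
  proof
    show "\<bar>s\<bar> \<le> Max (abs ` A)" if "s \<in> A" for s using assms that by simp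
    show "Max (abs ` A) \<ge> 0" using assms by (auto simp: Max_ge_iff)
  qed
  define a where "a = card A"
  have a: "a > 0" using assms by (simp add: a_def card_gt_0_iff)
  have "\<exists>T. finite T \<and> {0..int n} \<subseteq> {t + s |t s. t \<in> T \<and> s \<in> A} \<and>
    real (card T) \<le> (real n + (2 * D + 1)) * ((1 + ln a) / a) + 1" for n :: nat
  proof -
    \<comment> \<open>The margin \<open>D\<close> admits every \<open>u - s\<close>, and the size of
      \<open>I\<close> gives the constant \<open>2 * D + 1\<close>.\<close>
    define I where "I = {- D..int n + D}"
    have deg: "a \<le> card {t \<in> I. u \<in> (+) t ` A}" if "u \<in> {0..int n}" for u
    proof -
      have "(\<lambda>s. u - s) ` A \<subseteq> {t \<in> I. u \<in> (+) t ` A}"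
        using D that by (force simp: I_def image_iff)
      then have "card ((\<lambda>s. u - s) ` A) \<le> card {t \<in> I. u \<in> (+) t ` A}"
        by (intro card_mono finite_Collect_conjI) (simp_all add: I_def)
      then show ?thesis by (simp add: card_image inj_on_def a_def)
    qed
    obtain T where T: "T \<subseteq> I" "{0..int n} \<subseteq> (\<Union>t\<in>T. (+) t ` A)"
      "real (card T) \<le> real (card I) / a * ln a + 1 + real (card {0..int n}) / a"
      using stein_lovasz_cover[of "{0..int n}" I, OF _ _ a deg] unfolding I_def by blast
    have cI: "real (card I) = real n + (2 * D + 1)" using D by (simp add: I_def)
    \<comment> \<open>Enlarging \<open>n + 1\<close> to \<open>card I\<close> merges the leftover
      term with the logarithmic one.\<close>
    have "real (card {0..int n}) / a \<le> real (card I) / a"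
      using D by (intro divide_right_mono) (auto simp: cI)
    with T(3) have "real (card T) \<le> (real n + (2 * D + 1)) * ((1 + ln a) / a) + 1"
      unfolding cI by (simp add: algebra_simps add_divide_distrib)
    moreover have "finite T" using T(1) by (rule finite_subset) (simp add: I_def)
    moreover have "{0..int n} \<subseteq> {t + s |t s. t \<in> T \<and> s \<in> A}" using T(2) by blast
    ultimately show ?thesis by blast
  qed
  then show ?thesis unfolding a_def by blast
qed

section \<open>Optimal coverings and the density \<open>tau\<close>\<close>

lemma tau_upto_le:
  assumes "finite T" "{0..x} \<subseteq> {t + s |t s. t \<in> T \<and> s \<in> S}"
  shows "tau_upto S x \<le> card T"
  unfolding tau_upto_def by (rule Least_le) (use assms in blast)

text \<open>Copies of \<open>{a..b}\<close> laid end to end already cover \<open>{0..x}\<close>, so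
  the \<open>LEAST\<close> ranges over a non-empty set.\<close>

lemma tau_upto_attained:
  fixes S :: "real set"
  assumes "a < b" "{a..b} \<subseteq> S"
  obtains T where "finite T" "card T = tau_upto S x" "{0..x} \<subseteq> {t + s |t s. t \<in> T \<and> s \<in> S}"
proof -
  \<comment> \<open>The shift by \<open>- a\<close> moves copy \<open>i\<close> of
    \<open>{a..b}\<close> to start at \<open>i * (b - a)\<close>.\<close>
  define T where "T = (\<lambda>i. real_of_int i * (b - a) - a) ` {0..\<lfloor>x / (b - a)\<rfloor>}"
  have "{0..x} \<subseteq> {t + s |t s. t \<in> T \<and> s \<in> S}"
  proof
    fix y assume y: "y \<in> {0..x}"
    define i where "i = \<lfloor>y / (b - a)\<rfloor>"
    have "0 \<le> i" "i \<le> \<lfloor>x / (b - a)\<rfloor>"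
      using y assms by (auto simp: i_def intro!: floor_mono divide_right_mono)
    then have "real_of_int i * (b - a) - a \<in> T" by (auto simp: T_def)
    moreover have "real_of_int i \<le> y / (b - a)" "y / (b - a) \<le> real_of_int i + 1"
      unfolding i_def by linarith+
    then have "y - (real_of_int i * (b - a) - a) \<in> {a..b}"
      using assms by (simp add: field_simps)
    ultimately show "y \<in> {t + s |t s. t \<in> T \<and> s \<in> S}"
      using assms by (intro CollectI exI[of _ "real_of_int i * (b - a) - a"]
        exI[of _ "y - (real_of_int i * (b - a) - a)"]) auto
  qed
  then have "\<exists>n T. finite T \<and> card T = n \<and> {0..x} \<subseteq> {t + s |t s. t \<in> T \<and> s \<in> S}"
    by (auto simp: T_def)
  from LeastI_ex[OF this] show thesis using that unfolding tau_upto_def by blast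
qed

lemma mono_tau_upto:
  assumes "a < b" "{a..b} \<subseteq> S"
  shows "mono (tau_upto S)"
proof
  fix x y :: real assume "x \<le> y"
  obtain T where T: "finite T" "card T = tau_upto S y" "{0..y} \<subseteq> {t + s |t s. t \<in> T \<and> s \<in> S}"
    using tau_upto_attained[OF assms] .
  have "{0..x} \<subseteq> {0..y}" using \<open>x \<le> y\<close> by auto
  with T(3) have "{0..x} \<subseteq> {t + s |t s. t \<in> T \<and> s \<in> S}" by (rule order_trans[rotated])
  from tau_upto_le[OF T(1) this] show "tau_upto S x \<le> tau_upto S y" by (simp only: T(2))
qed

lemma tau_upto_subadditive:
  assumes "a < b" "{a..b} \<subseteq> S"
  shows "tau_upto S (x + y) \<le> tau_upto S x + tau_upto S y"
proof -
  obtain T where T: "finite T" "card T = tau_upto S x" "{0..x} \<subseteq> {t + s |t s. t \<in> T \<and> s \<in> S}"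
    using tau_upto_attained[OF assms] .
  obtain T' where T': "finite T'" "card T' = tau_upto S y" "{0..y} \<subseteq> {t + s |t s. t \<in> T' \<and> s \<in> S}"
    using tau_upto_attained[OF assms] .
  have "{0..x + y} \<subseteq> {t + s |t s. t \<in> T \<union> (+) x ` T' \<and> s \<in> S}"
  proof
    fix z assume z: "z \<in> {0..x + y}"
    show "z \<in> {t + s |t s. t \<in> T \<union> (+) x ` T' \<and> s \<in> S}"
    proof (cases "z \<le> x")
      case True
      then show ?thesis using z T(3) by fastforce
    next
      case False
      then have "z - x \<in> {0..y}" using z by simp
      then obtain t s where "z - x = t + s" "t \<in> T'" "s \<in> S" using T'(3) by blast
      then have "z = (x + t) + s" "x + t \<in> T \<union> (+) x ` T'" by auto
      then show ?thesis using \<open>s \<in> S\<close> by blast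
    qed
  qed
  then have "tau_upto S (x + y) \<le> card (T \<union> (+) x ` T')"
    using T T' by (intro tau_upto_le) auto
  also have "\<dots> \<le> card T + card ((+) x ` T')" by (rule card_Un_le)
  also have "\<dots> = tau_upto S x + tau_upto S y" using T T' by (simp add: card_image)
  finally show ?thesis .
qed

text \<open>The limit exists by \<open>fekete_real\<close>, so the \<open>Lim\<close> in
  \<open>tau\<close> has its intended value. As an infimum it is bounded above by each single
  \<open>x\<close> and below by any bound uniform in \<open>x\<close>.\<close>

lemma tau_eq_INF:
  assumes "a < b" "{a..b} \<subseteq> S"
  shows "tau S = (INF x\<in>{0<..}. real (tau_upto S x) / x)"
proof -
  have "((\<lambda>x. real (tau_upto S x) / x) \<longlongrightarrow> (INF x\<in>{0<..}. real (tau_upto S x) / x)) at_top"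
    using mono_tau_upto[OF assms] tau_upto_subadditive[OF assms]
    by (intro fekete_real) (auto simp: mono_def simp flip: of_nat_add)
  then show ?thesis unfolding tau_def by (intro tendsto_Lim) auto
qed

lemma tau_le:
  assumes "a < b" "{a..b} \<subseteq> S" "x > 0"
  shows "tau S \<le> real (tau_upto S x) / x"
  unfolding tau_eq_INF[OF assms(1,2)]
  by (rule cINF_lower) (use assms in \<open>auto intro!: bdd_belowI[of _ 0]\<close>)

text \<open>Translates covering \<open>{0..x}\<close> have total measure at least \<open>x\<close>.
  This keeps \<open>kappa S\<close> positive when reciprocals are taken for the efficiency.\<close>

lemma kappa_ge_1:
  fixes S :: "real set"
  assumes "a < b" "{a..b} \<subseteq> S" "S \<in> lmeasurable"
  shows "kappa S \<ge> 1"
proof -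
  have "measure lebesgue {a..b} \<le> measure lebesgue S"
    using assms by (intro measure_mono_fmeasurable) auto
  then have pos: "measure lebesgue S > 0" using assms by simp
  have "1 / measure lebesgue S \<le> real (tau_upto S x) / x" if "x > 0" for x
  proof -
    obtain T where T: "finite T" "card T = tau_upto S x" "{0..x} \<subseteq> {t + s |t s. t \<in> T \<and> s \<in> S}"
      using tau_upto_attained[OF assms(1,2)] .
    have "{0..x} \<subseteq> (\<Union>t\<in>T. (+) t ` S)" using T(3) by blast
    then have "measure lebesgue {0..x} \<le> measure lebesgue (\<Union>t\<in>T. (+) t ` S)"
      using T assms by (intro measure_mono_fmeasurable)
        (auto intro!: fmeasurable.finite_UN measurable_translation)
    also have "\<dots> \<le> (\<Sum>t\<in>T. measure lebesgue ((+) t ` S))"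
      using T assms by (intro measure_UNION_le) (auto dest: measurable_translation fmeasurableD)
    also have "\<dots> = real (tau_upto S x) * measure lebesgue S"
      using T by (simp add: measure_translation)
    finally show ?thesis using that pos by (simp add: field_simps)
  qed
  then have "1 / measure lebesgue S \<le> tau S"
    unfolding tau_eq_INF[OF assms(1,2)] by (intro cINF_greatest) auto
  then show ?thesis unfolding kappa_def using pos by (simp add: field_simps)
qed

section \<open>Grid cells and the passage from integers to reals\<close>

text \<open>Half-open cells partition the line when \<open>h > 0\<close>, so the index of a point is
  a floor.\<close>

definition cell :: "real \<Rightarrow> int \<Rightarrow> real set" where
  "cell h j = {real_of_int j * h..<(real_of_int j + 1) * h}"

lemma mem_cell_iff: "h > 0 \<Longrightarrow> x \<in> cell h j \<longleftrightarrow> \<lfloor>x / h\<rfloor> = j"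
  unfolding cell_def by (auto simp: floor_eq_iff field_simps)

lemma disjoint_cells: "h > 0 \<Longrightarrow> disjoint_family_on (cell h) A"
  by (auto simp: disjoint_family_on_def mem_cell_iff)

lemma measure_UN_cells:
  assumes "h > 0" "finite A"
  shows "measure lebesgue (\<Union>j\<in>A. cell h j) = real (card A) * h"
    and "(\<Union>j\<in>A. cell h j) \<in> lmeasurable"
proof -
  have lm: "cell h j \<in> lmeasurable" for j
    unfolding cell_def by (intro bounded_set_imp_lmeasurable) auto
  have "measure lebesgue (\<Union>j\<in>A. cell h j) = (\<Sum>j\<in>A. measure lebesgue (cell h j))"
    using fmeasurableD[OF lm] fmeasurableD2[OF lm] assms
    unfolding infinity_ennreal_def[symmetric]
    by (intro measure_finite_Union disjoint_cells) blast+
  also have "\<dots> = real (card A) * h"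
    using assms by (simp add: cell_def algebra_simps)
  finally show "measure lebesgue (\<Union>j\<in>A. cell h j) = real (card A) * h" .
  show "(\<Union>j\<in>A. cell h j) \<in> lmeasurable" using lm assms by (intro fmeasurable.finite_UN) auto
qed

text \<open>Scaling by \<open>h\<close> turns an integer covering by translates of \<open>A\<close>
  into a real covering by translates of \<open>S\<close>; its density is then taken as
  \<open>n\<close> grows.\<close>

lemma tau_le_cells:
  fixes A :: "int set" and h :: real
  assumes "h > 0" "finite A" "A \<noteq> {}" and sub: "\<And>j. j \<in> A \<Longrightarrow> cell h j \<subseteq> S"
    and ab: "a < b" "{a..b} \<subseteq> S"
  shows "tau S \<le> (1 + ln (card A)) / (card A * h)"
proof -
  define r where "r = (1 + ln (card A)) / card A"
  obtain c where c: "\<And>n::nat. \<exists>T. finite T \<and> {0..int n} \<subseteq> {t + s |t s. t \<in> T \<and> s \<in> A} \<and>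
    real (card T) \<le> (real n + c) * r + 1"
    using integer_translates_cover[OF assms(2,3)] unfolding r_def by blast
  have bound: "tau S \<le> ((real n + c) * r + 1) / (real n * h)" if "n > 0" for n :: nat
  proof -
    obtain T where T: "finite T" "{0..int n} \<subseteq> {t + s |t s. t \<in> T \<and> s \<in> A}"
      "real (card T) \<le> (real n + c) * r + 1" using c by blast
    define T' where "T' = (\<lambda>t. real_of_int t * h) ` T"
    have "{0..real n * h} \<subseteq> {t + s |t s. t \<in> T' \<and> s \<in> S}"
    proof
      fix x assume x: "x \<in> {0..real n * h}"
      define j where "j = \<lfloor>x / h\<rfloor>"
      have "j \<in> {0..int n}" using x \<open>h > 0\<close>
        by (auto simp: j_def floor_le_iff field_simps)
      then obtain t s where ts: "j = t + s" "t \<in> T" "s \<in> A" using T(2) by blast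
      \<comment> \<open>Translation by a multiple of \<open>h\<close> permutes the cells, so the
        shifted point lies in \<open>cell h s\<close>, inside \<open>S\<close>.\<close>
      have "\<lfloor>(x - real_of_int t * h) / h\<rfloor> = j - t"
        using \<open>h > 0\<close> by (simp add: diff_divide_distrib j_def)
      then have "x - real_of_int t * h \<in> S"
        using ts sub[of s] mem_cell_iff[OF \<open>h > 0\<close>, of "x - real_of_int t * h" s] by auto
      moreover have "real_of_int t * h \<in> T'" using ts by (auto simp: T'_def)
      ultimately show "x \<in> {t + s |t s. t \<in> T' \<and> s \<in> S}"
        by (force intro: exI[of _ "real_of_int t * h"])
    qed
    then have "tau_upto S (real n * h) \<le> card T'"
      using T by (intro tau_upto_le) (auto simp: T'_def)
    also have "\<dots> \<le> card T" unfolding T'_def using T by (intro card_image_le)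
    finally have "real (tau_upto S (real n * h)) \<le> (real n + c) * r + 1" using T by linarith
    then have "real (tau_upto S (real n * h)) / (real n * h) \<le> ((real n + c) * r + 1) / (real n * h)"
      using \<open>h > 0\<close> by (intro divide_right_mono) auto
    then show ?thesis using tau_le[OF ab, of "real n * h"] that \<open>h > 0\<close> by simp
  qed
  have "(\<lambda>n. ((real n + c) * r + 1) / (real n * h)) \<longlonglongrightarrow> r / h"
    using \<open>h > 0\<close> unfolding divide_inverse by real_asymp
  then have "tau S \<le> r / h"
    by (rule LIMSEQ_le_const) (use bound in \<open>auto intro!: exI[of _ 1]\<close>)
  then show ?thesis by (simp add: r_def)
qed

section \<open>Counting cells for a union of intervals and choosing the grid\<close>

text \<open>A cell of the grid that meets \<open>S\<close> without being contained in it contains one of the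
  \<open>2k\<close> endpoints.\<close>
lemma kappa_le_of_grid:
  fixes a b :: "nat \<Rightarrow> real"
  assumes ab: "\<And>i. i \<in> {1..k} \<Longrightarrow> a i < b i" and k: "k \<ge> 1"
    and S: "S = (\<Union>i\<in>{1..k}. {a i..b i})" and M: "M > 2 * real k"
  shows "kappa S \<le> (1 + ln M) * (M / (M - 2 * real k))"
proof -
  have lm: "S \<in> lmeasurable" unfolding S by (intro fmeasurable.finite_UN) auto
  have one: "a 1 < b 1" "{a 1..b 1} \<subseteq> S" using ab[of 1] k by (auto simp: S)
  have "measure lebesgue {a 1..b 1} \<le> measure lebesgue S"
    using one lm by (intro measure_mono_fmeasurable) auto
  define \<mu> where "\<mu> = measure lebesgue S"
  have mu: "\<mu> > 0" using \<open>_ \<le> measure lebesgue S\<close> one by (simp add: \<mu>_def)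
  define h where "h = \<mu> / M"
  have h: "h > 0" "\<mu> = M * h" using mu M by (auto simp: h_def)
  define A where "A = {j. cell h j \<subseteq> S}"
  define B where "B = (\<lambda>x. \<lfloor>x / h\<rfloor>) ` S"
  define E where "E = (\<lambda>x. \<lfloor>x / h\<rfloor>) ` (a ` {1..k} \<union> b ` {1..k})"
  have "B \<subseteq> (\<Union>i\<in>{1..k}. {\<lfloor>a i / h\<rfloor>..\<lfloor>b i / h\<rfloor>})"
    using h by (fastforce simp: B_def S intro!: floor_mono divide_right_mono)
  then have finB: "finite B" by (rule finite_subset) auto
  have AB: "A \<subseteq> B"
  proof
    fix j assume "j \<in> A"
    moreover have "real_of_int j * h \<in> cell h j" using h by (simp add: cell_def)
    ultimately have "real_of_int j * h \<in> S" by (auto simp: A_def)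
    moreover have "\<lfloor>real_of_int j * h / h\<rfloor> = j" using h by simp
    ultimately show "j \<in> B" unfolding B_def by (metis imageI)
  qed
  then have finA: "finite A" using finB finite_subset by blast
  have "B - A \<subseteq> E"
  proof
    fix j assume j: "j \<in> B - A"
    then obtain p where p: "p \<in> S" "j = \<lfloor>p / h\<rfloor>" by (auto simp: B_def)
    obtain q where q: "q \<in> cell h j" "q \<notin> S" using j by (auto simp: A_def)
    have pc: "p \<in> cell h j" using p h by (simp add: mem_cell_iff)
    obtain i where i: "i \<in> {1..k}" "p \<in> {a i..b i}" using p by (auto simp: S)
    have "q \<notin> {a i..b i}" using i q unfolding S by blast
    \<comment> \<open>The cell is convex and contains \<open>p\<close> and \<open>q\<close>, hence
      also the endpoint separating them.\<close>
    then have "q < a i \<or> b i < q" by auto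
    then have "a i \<in> cell h j \<or> b i \<in> cell h j"
      using i q(1) pc by (auto simp: cell_def)
    then show "j \<in> E" using i h unfolding E_def mem_cell_iff[OF h(1)] by blast
  qed
  then have "card (B - A) \<le> card E" by (intro card_mono) (auto simp: E_def)
  also have "\<dots> \<le> card (a ` {1..k} \<union> b ` {1..k})" unfolding E_def by (intro card_image_le) auto
  also have "\<dots> \<le> card (a ` {1..k}) + card (b ` {1..k})" by (rule card_Un_le)
  also have "\<dots> \<le> k + k" using card_image_le[of "{1..k}" a] card_image_le[of "{1..k}" b] by simp
  finally have BA: "real (card B) \<le> real (card A) + 2 * real k"
    using card_Diff_subset[OF finA AB] by linarith
  \<comment> \<open>Comparing measures with \<open>\<mu> = M * h\<close> gives at least
    \<open>M\<close> cells in \<open>B\<close> and at most \<open>M\<close> in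
    \<open>A\<close>.\<close>
  have "S \<subseteq> (\<Union>j\<in>B. cell h j)" using h by (auto simp: B_def mem_cell_iff)
  then have "\<mu> \<le> measure lebesgue (\<Union>j\<in>B. cell h j)" unfolding \<mu>_def
    using lm measure_UN_cells[OF h(1) finB] by (intro measure_mono_fmeasurable) auto
  then have "M \<le> card B" using h measure_UN_cells[OF h(1) finB] by simp
  with BA have lower: "M - 2 * real k \<le> card A" by linarith
  have "measure lebesgue (\<Union>j\<in>A. cell h j) \<le> \<mu>" unfolding \<mu>_def
    using lm measure_UN_cells[OF h(1) finA]
    by (intro measure_mono_fmeasurable) (auto simp: A_def)
  then have upper: "card A \<le> M" using h measure_UN_cells[OF h(1) finA] by simp
  have pos: "card A > 0" using lower M by linarith
  then have "A \<noteq> {}" by auto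
  have "1 \<le> real k" using k by simp
  with M have "0 \<le> 1 + ln M" by simp
  have "tau S \<le> (1 + ln (card A)) / (card A * h)"
    using one finA \<open>A \<noteq> {}\<close> h by (intro tau_le_cells) (auto simp: A_def)
  then have "kappa S \<le> (1 + ln (card A)) / (card A * h) * \<mu>"
    unfolding kappa_def \<mu>_def[symmetric] using mu by (intro mult_right_mono) auto
  also have "\<dots> = (1 + ln (card A)) * (M / card A)" using h by simp
  also have "\<dots> \<le> (1 + ln M) * (M / (M - 2 * real k))"
  proof (rule mult_mono)
    show "1 + ln (card A) \<le> 1 + ln M" using upper pos by simp
    show "M / card A \<le> M / (M - 2 * real k)" using lower M by (intro divide_left_mono) auto
  qed (use M \<open>0 \<le> 1 + ln M\<close> in auto)
  finally show ?thesis .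
qed

text \<open>The concave function \<open>ln\<close> lies below its tangent at \<open>y\<close>. It is
  used at \<open>y = 8\<close>, where \<open>3 * ln 2\<close> has a rational bound.\<close>

lemma ln_le_divide_add:
  fixes x y :: real
  assumes "x > 0" "y > 0"
  shows "ln x \<le> ln y + x / y - 1"
  using ln_le_minus_one[of "x / y"] assms by (simp add: ln_div)

text \<open>The number of cells is \<open>M = k (2 ln k + 5)\<close>: one of order \<open>k ln k\<close> makes the boundary
  loss cost only \<open>O(1)\<close>, and the constant \<open>5\<close> makes the estimate hold down to \<open>k = 2\<close>.\<close>
lemma grid_bound_le:
  fixes k :: nat
  assumes "k \<ge> 2"
  defines "M \<equiv> real k * (2 * ln (real k) + 5)"
  shows "M > 2 * real k"
    and "(1 + ln M) * (M / (M - 2 * real k)) \<le> ln (real k) + ln (ln (real k)) + 5"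
proof -
  define L where "L = ln (real k)"
  have "ln 2 \<le> L" using assms by (simp add: L_def)
  then have L: "L \<ge> 2 / 3" using ln2_ge_two_thirds by linarith
  have M: "M = real k * (2 * L + 5)" by (simp add: M_def L_def)
  have "real k * 2 < real k * (2 * L + 5)"
    using assms L by (intro mult_strict_left_mono) auto
  then show "M > 2 * real k" by (simp add: M)
  have ln8: "ln (8::real) \<le> 25 / 12"
    using ln_realpow[of 2 3] ln2_le_25_over_36 by simp
  have lnM: "ln M = L + ln (2 * L + 5)"
    using assms L by (simp add: M ln_mult_pos flip: L_def)
  \<comment> \<open>Equality holds at \<open>L = 2 / 3\<close>, the lower bound available for
    \<open>L\<close>.\<close>
  have "2 * L + 5 \<le> L * (19 / 2)" using L by simp
  then have "ln (2 * L + 5) \<le> ln (L * (19 / 2))" using L by (subst ln_le_cancel_iff) auto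
  also have "\<dots> = ln L + ln (19 / 2)" using L by (intro ln_mult_pos) auto
  finally have b1: "ln (2 * L + 5) \<le> ln L + 109 / 48"
    using ln_le_divide_add[of "19 / 2" 8] ln8 by simp
  have b2: "ln (2 * L + 5) \<le> 41 / 24 + L / 4"
    using ln_le_divide_add[of "2 * L + 5" 8] ln8 L by (simp add: field_simps)
  \<comment> \<open>The constant \<open>83 / 48\<close> is what remains of \<open>5\<close> after
    subtracting \<open>1\<close> and the \<open>109 / 48\<close> of \<open>b1\<close>.\<close>
  have "1 + ln M \<le> (83 / 48) * (L + 3 / 2)" using b2 L by (simp add: lnM)
  then have b3: "(1 + ln M) / (L + 3 / 2) \<le> 83 / 48" using L by (simp add: divide_le_eq)
  have "M / (M - 2 * real k) = (2 * L + 5) / (2 * L + 3)"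
  proof -
    have "M - 2 * real k = real k * (2 * L + 3)" by (simp add: M algebra_simps)
    then show ?thesis using assms(1) by (simp add: M)
  qed
  also have "\<dots> = 1 + 1 / (L + 3 / 2)" using L by (simp add: field_simps)
  finally have "(1 + ln M) * (M / (M - 2 * real k)) = 1 + ln M + (1 + ln M) / (L + 3 / 2)"
    by (simp add: algebra_simps)
  also have "\<dots> \<le> L + ln L + 5" using b1 b3 lnM by linarith
  finally show "(1 + ln M) * (M / (M - 2 * real k)) \<le> ln (real k) + ln (ln (real k)) + 5"
    by (simp add: L_def)
qed

theorem theorem9p1:
  "(\<forall>(k::nat) S. k \<ge> 2 \<and> union_of_intervals k S \<longrightarrow>
      kappa S \<le> ln (real k) + ln (ln (real k)) + 5) \<and>
   (\<exists>\<epsilon> :: nat \<Rightarrow> real. \<epsilon> \<longlonglongrightarrow> 0 \<and>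
      (\<forall>(k::nat) S. k \<ge> 2 \<and> union_of_intervals k S \<longrightarrow>
         efficiency S \<ge> (1 - \<epsilon> k) / ln (real k)))"
proof -
  have main: "1 \<le> kappa S \<and> kappa S \<le> ln (real k) + ln (ln (real k)) + 5"
    if k: "k \<ge> 2" and "union_of_intervals k S" for k :: nat and S
  proof -
    obtain a b where ab: "\<And>i. i \<in> {1..k} \<Longrightarrow> a i < b i" and S: "S = (\<Union>i\<in>{1..k}. {a i..b i})"
      using \<open>union_of_intervals k S\<close> unfolding union_of_intervals_def by blast
    have "S \<in> lmeasurable" unfolding S by (intro fmeasurable.finite_UN) auto
    then have "1 \<le> kappa S" using ab[of 1] k by (intro kappa_ge_1[of "a 1" "b 1"]) (force simp: S)+
    moreover have "kappa S \<le> ln (real k) + ln (ln (real k)) + 5"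
      using kappa_le_of_grid[OF ab _ S grid_bound_le(1)[OF k]] grid_bound_le(2)[OF k] k by linarith
    ultimately show ?thesis ..
  qed
  \<comment> \<open>Chosen so that \<open>(1 - \<epsilon> k) / ln k\<close> is exactly the
    reciprocal of the upper bound for \<open>kappa S\<close>; it tends to \<open>0\<close> because
    \<open>ln (ln k)\<close> is negligible against \<open>ln k\<close>.\<close>
  define \<epsilon> :: "nat \<Rightarrow> real" where
    "\<epsilon> k = 1 - ln (real k) / (ln (real k) + ln (ln (real k)) + 5)" for k
  have "\<epsilon> \<longlonglongrightarrow> 0" unfolding \<epsilon>_def by real_asymp
  moreover have "efficiency S \<ge> (1 - \<epsilon> k) / ln (real k)"
    if "k \<ge> 2" "union_of_intervals k S" for k :: nat and S
  proof -
    have "(1 - \<epsilon> k) / ln (real k) = 1 / (ln (real k) + ln (ln (real k)) + 5)"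
      using that(1) by (simp add: \<epsilon>_def)
    also have "\<dots> \<le> 1 / kappa S" using main[OF that] by (intro divide_left_mono) auto
    finally show ?thesis by (simp add: efficiency_def)
  qed
  ultimately show ?thesis using main by blast
qed

end
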